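(* Let $N>2$, let $\alpha_\mu<0$ for $0<\mu<N$ be fixed, let $\tau\in\{1,\dots,N-1\}$ be an index with $|\alpha_\tau|=\min_{0<\mu<N}|\alpha_\mu|$, and put $$\alpha_{(d)}:=\Big(\sum_{\mu=1,\,\mu\neq\tau}^{N-1}|\alpha_\mu|^{-1}\Big)^{-1}.$$ If $|\alpha_\tau|<\alpha_{(d)}$, then the number $\alpha_{(c')}$ defined by $$\alpha_{(c')}^{-1}=|\alpha_\tau|^{-1}-\alpha_{(d)}^{-1}$$ satisfies $0<\alpha_{(c')}<\infty$, and in the domain $|\alpha_\tau|<\alpha_0<\infty$ a phase transition from a coplanar to a collinear lowest energy configuration takes place at $\alpha_0=\alpha_{(c')}$: for $\alpha_0>|\alpha_\tau|$ the lowest energy configuration is collinear if and only if $\alpha_0\ge\alpha_{(c')}$, and in this case it is the state $\boldsymbol\Psi_{\uparrow\ldots\downarrow}$.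
   Context: Spin polygon: unit vectors $\mathbf{s}_0,\dots,\mathbf{s}_{N-1}\in\mathbb{R}^3$ (indices modulo $N$) with energy $E=\sum_{\mu=0}^{N-1}\alpha_\mu\,\mathbf{s}_\mu\cdot\mathbf{s}_{\mu+1}$, where $\alpha_0>0$ and $\alpha_\mu<0$ for $0<\mu<N$. A lowest energy configuration (LEC) is a global minimizer of $E$. It is collinear (coplanar) if its vectors span a one-dimensional (two-dimensional) subspace; every LEC is one or the other. The state $\boldsymbol\Psi_{\uparrow\ldots\downarrow}$ is the collinear configuration, unique up to global rotation, with $\mathbf{s}_{\mu+1}=\mathbf{s}_\mu$ for $0<\mu<N$, $\mu\ne\tau$, while $\mathbf{s}_{\tau+1}=-\mathbf{s}_\tau$ and $\mathbf{s}_1=-\mathbf{s}_0$. *)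

theory Defs
  imports "HOL-Analysis.Analysis"
begin

text \<open>A spin configuration on the \<open>N\<close>-gon is a function \<open>s :: nat \<Rightarrow> real ^ 3\<close> of which only the
  values at indices below \<open>N\<close> matter; the neighbour of site \<open>\<mu>\<close> is \<open>Suc \<mu> mod N\<close>.\<close>

definition spin_config :: "nat \<Rightarrow> (nat \<Rightarrow> real ^ 3) \<Rightarrow> bool" where
  "spin_config N s \<longleftrightarrow> (\<forall>\<mu><N. norm (s \<mu>) = 1)"

definition energy :: "nat \<Rightarrow> (nat \<Rightarrow> real) \<Rightarrow> (nat \<Rightarrow> real ^ 3) \<Rightarrow> real" where
  "energy N \<alpha> s = (\<Sum>\<mu><N. \<alpha> \<mu> * (s \<mu> \<bullet> s (Suc \<mu> mod N)))"

definition LEC :: "nat \<Rightarrow> (nat \<Rightarrow> real) \<Rightarrow> (nat \<Rightarrow> real ^ 3) \<Rightarrow> bool" where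
  "LEC N \<alpha> s \<longleftrightarrow>
     spin_config N s \<and> (\<forall>t. spin_config N t \<longrightarrow> energy N \<alpha> s \<le> energy N \<alpha> t)"

definition collinear_config :: "nat \<Rightarrow> (nat \<Rightarrow> real ^ 3) \<Rightarrow> bool" where
  "collinear_config N s \<longleftrightarrow> dim (span (s ` {..<N})) = 1"

definition coplanar_config :: "nat \<Rightarrow> (nat \<Rightarrow> real ^ 3) \<Rightarrow> bool" where
  "coplanar_config N s \<longleftrightarrow> dim (span (s ` {..<N})) = 2"

text \<open>The state \<open>\<Psi>\<close> with one reversed bond at \<open>\<tau>\<close> and one at \<open>0\<close> is determined only up to a
  global rotation, so it is rendered as the predicate of being one of its representatives.\<close>

definition Psi_state :: "nat \<Rightarrow> nat \<Rightarrow> (nat \<Rightarrow> real ^ 3) \<Rightarrow> bool" where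
  "Psi_state N \<tau> s \<longleftrightarrow> spin_config N s
     \<and> (\<forall>\<mu>. 0 < \<mu> \<and> \<mu> < N \<and> \<mu> \<noteq> \<tau> \<longrightarrow> s (Suc \<mu> mod N) = s \<mu>)
     \<and> s (Suc \<tau> mod N) = - s \<tau>
     \<and> s 1 = - s 0"

definition alpha_d :: "nat \<Rightarrow> (nat \<Rightarrow> real) \<Rightarrow> nat \<Rightarrow> real" where
  "alpha_d N \<alpha> \<tau> = inverse (\<Sum>\<mu>\<in>{1..<N} - {\<tau>}. inverse \<bar>\<alpha> \<mu>\<bar>)"

text \<open>With \<open>inverse 0 = 0\<close>, the inequality \<open>0 < alpha_c' N \<alpha> \<tau>\<close> holds if and only if the
  difference below is positive, so it expresses \<open>0 < \<alpha>\<^sub>c\<^sub>' < \<infinity>\<close>.\<close>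

definition alpha_c' :: "nat \<Rightarrow> (nat \<Rightarrow> real) \<Rightarrow> nat \<Rightarrow> real" where
  "alpha_c' N \<alpha> \<tau> = inverse (inverse \<bar>\<alpha> \<tau>\<bar> - inverse (alpha_d N \<alpha> \<tau>))"

end

(* Flip the spins of one of the two blocks of Psi, and let d_mu be the difference of the flipped
   spins along bond mu. Then E - E(Psi) is half of
     sum_{mu <> tau} |alpha_mu| |d_mu|^2 - |alpha_tau| |d_tau|^2,
   and d_tau is minus the sum of the other d_mu. With S = 1/alpha_0 + 1/alpha_(d), the weighted
   Cauchy-Schwarz inequality bounds the sum below by |d_tau|^2 / S, so Psi is minimal if
   |alpha_tau| S <= 1, which means alpha_0 >= alpha_(c'). In the equality case the flipped spins lie
   on a line, on which there are at most two unit vectors; hence all d_mu vanish. If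
   |alpha_tau| S > 1, then rotating the flipped spins in a plane by small angles with increments
   proportional to 1/|alpha_mu| lowers the energy below E(Psi), which is the least energy of a
   collinear configuration. A minimizer spans at most a plane because each spin is parallel to its
   local field, a three-term recurrence. *)

theory Submission
  imports Defs "HOL-Real_Asymp.Real_Asymp"
begin

section \<open>Cyclic sums and inner product spaces\<close>

lemma sum_cyclic_differences:
  fixes u :: "nat \<Rightarrow> 'a::ab_group_add"
  assumes "N > 0"
  shows "(\<Sum>\<mu><N. u (Suc \<mu> mod N) - u \<mu>) = 0"
proof -
  obtain m where m: "N = Suc m"
    using assms gr0_implies_Suc by blast
  have "(\<Sum>\<mu><N. u (Suc \<mu> mod N)) = (\<Sum>\<mu><m. u (Suc \<mu>)) + u 0"
    by (simp add: m)
  also have "\<dots> = (\<Sum>\<mu><N. u \<mu>)"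
    unfolding m sum.lessThan_Suc_shift by (simp add: add.commute)
  finally show ?thesis
    by (simp add: sum_subtractf)
qed

text \<open>Weighted Cauchy-Schwarz as an identity: completing the square around the minimizer
  \<open>d i = (inverse (w i) / S) *\<^sub>R v\<close> leaves an explicit remainder. Its
  nonnegativity gives the lower bound, its vanishing the equality case.\<close>

lemma weighted_sum_norm_power2:
  fixes d :: "'i \<Rightarrow> 'a::real_inner" and w :: "'i \<Rightarrow> real"
  assumes fin: "finite A" and ne: "A \<noteq> {}" and pos: "\<And>i. i \<in> A \<Longrightarrow> 0 < w i"
  defines "S \<equiv> \<Sum>i\<in>A. inverse (w i)" and "v \<equiv> \<Sum>i\<in>A. d i"
  shows "(\<Sum>i\<in>A. w i * (norm (d i))\<^sup>2)
    = (norm v)\<^sup>2 / S + (\<Sum>i\<in>A. w i * (norm (d i - (inverse (w i) / S) *\<^sub>R v))\<^sup>2)"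
proof -
  have S: "S > 0"
    unfolding S_def using fin ne pos by (intro sum_pos) auto
  have "w i * (norm (d i - (inverse (w i) / S) *\<^sub>R v))\<^sup>2
      = w i * (norm (d i))\<^sup>2 - (2 / S) * (d i \<bullet> v) + inverse (w i) * ((norm v)\<^sup>2 / S\<^sup>2)" if "i \<in> A" for i
  proof -
    have expand: "(norm (d i - c *\<^sub>R v))\<^sup>2 = (norm (d i))\<^sup>2 - 2 * c * (d i \<bullet> v) + c\<^sup>2 * (norm v)\<^sup>2" for c
      unfolding power2_norm_eq_inner
      by (simp add: inner_diff_left inner_diff_right inner_commute algebra_simps power2_eq_square)
    show ?thesis
      unfolding expand using pos[OF that] S by (simp add: field_simps power2_eq_square)
  qed
  then have "(\<Sum>i\<in>A. w i * (norm (d i - (inverse (w i) / S) *\<^sub>R v))\<^sup>2)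
      = (\<Sum>i\<in>A. w i * (norm (d i))\<^sup>2) - (2 / S) * (v \<bullet> v) + S * ((norm v)\<^sup>2 / S\<^sup>2)"
    by (simp add: sum.distrib sum_subtractf S_def v_def inner_sum_left sum_distrib_left
        sum_distrib_right sum_divide_distrib)
  then show ?thesis
    using S dot_square_norm[of v] by (simp add: field_simps power2_eq_square)
qed

text \<open>The squared norm along a line is quadratic in the parameter, so a genuine line cannot
  meet the unit sphere at the three distinct parameters 0, \<open>a\<close> and
  \<open>a + b\<close>.\<close>

lemma norm_add_scaleR_unit_unique:
  fixes x v :: "'a::real_inner"
  assumes "norm x = 1" "norm (x + a *\<^sub>R v) = 1" "norm (x + (a + b) *\<^sub>R v) = 1" "a > 0" "b > 0"
  shows "v = 0"
proof -
  have "x \<bullet> x = 1" "(x + a *\<^sub>R v) \<bullet> (x + a *\<^sub>R v) = 1"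
      "(x + (a + b) *\<^sub>R v) \<bullet> (x + (a + b) *\<^sub>R v) = 1"
    using assms by (simp_all add: norm_eq_1)
  then have "a * (2 * (x \<bullet> v) + a * (v \<bullet> v)) = 0" "(a + b) * (2 * (x \<bullet> v) + (a + b) * (v \<bullet> v)) = 0"
    by (simp_all add: algebra_simps inner_commute)
  then have "2 * (x \<bullet> v) + a * (v \<bullet> v) = 0" "2 * (x \<bullet> v) + (a + b) * (v \<bullet> v) = 0"
    using assms by auto
  then have "b * (v \<bullet> v) = 0"
    unfolding distrib_right by linarith
  then show ?thesis
    using assms by simp
qed

text \<open>Comparing \<open>y\<close> with the unit vector opposite to \<open>h\<close> forces
  equality in Cauchy-Schwarz. This is the condition that a spin of a minimizer is antiparallel to
  its local field, unless that field is zero.\<close>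

lemma inner_unit_minimizer:
  fixes h y :: "'a::real_inner"
  assumes "norm y = 1" and min: "\<And>x. norm x = 1 \<Longrightarrow> h \<bullet> y \<le> h \<bullet> x"
  shows "h = - norm h *\<^sub>R y"
proof (cases "h = 0")
  case False
  then have "h \<bullet> y \<le> h \<bullet> (- inverse (norm h) *\<^sub>R h)"
    by (intro min) simp
  also have "\<dots> = - norm h"
    using False by (simp add: dot_square_norm power2_eq_square field_simps)
  finally have "h \<bullet> y \<le> - norm h" .
  then have "norm h * (h \<bullet> y) \<le> - (norm h * norm h)"
    using mult_left_mono[of "h \<bullet> y" "- norm h" "norm h"] by simp
  moreover have "(norm (h + norm h *\<^sub>R y))\<^sup>2 = 2 * (norm h * norm h) + 2 * (norm h * (h \<bullet> y))"
    using \<open>norm y = 1\<close> unfolding power2_norm_eq_inner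
    by (simp add: inner_add_left inner_add_right inner_commute norm_eq_1)
      (simp add: dot_square_norm power2_eq_square)
  ultimately have "(norm (h + norm h *\<^sub>R y))\<^sup>2 \<le> 0"
    by simp
  then show ?thesis
    by (simp add: eq_neg_iff_add_eq_0)
qed simp

section \<open>Existence and dimension of lowest energy configurations\<close>

text \<open>By Tychonoff the product of unit spheres over all indices is compact, and the energy is
  continuous on it.\<close>

lemma LEC_exists: "\<exists>s. LEC N \<alpha> s"
proof (cases "N = 0")
  case True
  then show ?thesis
    by (simp add: LEC_def spin_config_def energy_def)
next
  case False
  define K :: "(nat \<Rightarrow> real^3) set" where "K = Pi\<^sub>E UNIV (\<lambda>_. sphere 0 1)"
  have "compactin (product_topology (\<lambda>_. euclidean) UNIV) K"
    unfolding K_def by (simp add: compactin_PiE)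
  then have "compact K"
    by (simp add: euclidean_product_topology)
  moreover have "(\<lambda>_. axis 1 1) \<in> K"
    by (simp add: K_def PiE_iff)
  moreover have "continuous_on K (energy N \<alpha>)"
    unfolding energy_def
    by (intro continuous_intros continuous_on_subset[OF continuous_on_product_coordinates]) auto
  ultimately obtain s where s: "s \<in> K" "\<And>t. t \<in> K \<Longrightarrow> energy N \<alpha> s \<le> energy N \<alpha> t"
    by (metis continuous_attains_inf empty_iff)
  have "energy N \<alpha> s \<le> energy N \<alpha> t" if "spin_config N t" for t
  proof -
    \<comment> \<open>Membership in \<open>K\<close> constrains the values at every index, so
      \<open>t\<close> is extended periodically from the indices below \<open>N\<close>.\<close>
    define t' where "t' \<mu> = t (\<mu> mod N)" for \<mu>
    have "t' \<in> K"
      using that False by (simp add: K_def PiE_iff t'_def spin_config_def)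
    moreover have "energy N \<alpha> t' = energy N \<alpha> t"
      by (simp add: energy_def t'_def)
    ultimately show ?thesis
      using s(2) by metis
  qed
  moreover have "spin_config N s"
    using s(1) by (simp add: K_def spin_config_def PiE_iff)
  ultimately show ?thesis
    by (auto simp: LEC_def)
qed

text \<open>The energy is affine in each single spin, with the local field of the two neighbours as
  coefficient. The bounds on \<open>\<mu>\<close> select sites whose two bonds do not wrap
  around.\<close>

lemma energy_fun_upd:
  assumes "0 < \<mu>" "Suc \<mu> < N"
  shows "energy N \<alpha> (s(\<mu> := x)) - energy N \<alpha> s
    = (\<alpha> (\<mu> - 1) *\<^sub>R s (\<mu> - 1) + \<alpha> \<mu> *\<^sub>R s (Suc \<mu>)) \<bullet> (x - s \<mu>)"
proof -
  let ?t = "s(\<mu> := x)"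
  let ?g = "\<lambda>k. \<alpha> k * (?t k \<bullet> ?t (Suc k mod N)) - \<alpha> k * (s k \<bullet> s (Suc k mod N))"
  have "?g k = 0" if k: "k \<in> {..<N} - {\<mu> - 1, \<mu>}" for k
  proof -
    have "Suc k mod N \<noteq> \<mu>"
      using k assms by (cases "Suc k = N") auto
    then show ?thesis
      using k by simp
  qed
  then have "(\<Sum>k<N. ?g k) = (\<Sum>k\<in>{\<mu> - 1, \<mu>}. ?g k)"
    using assms by (intro sum.mono_neutral_right) auto
  also have "\<dots> = ?g (\<mu> - 1) + ?g \<mu>"
    using assms by simp
  also have "\<dots> = (\<alpha> (\<mu> - 1) *\<^sub>R s (\<mu> - 1) + \<alpha> \<mu> *\<^sub>R s (Suc \<mu>)) \<bullet> (x - s \<mu>)"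
    using assms by (simp add: algebra_simps inner_commute)
  finally show ?thesis
    by (simp add: energy_def sum_subtractf)
qed

text \<open>Minimality under changes of one spin makes the local field at \<open>m\<close> a
  multiple of \<open>s m\<close>. Solving for \<open>s (Suc m)\<close>, with division by
  \<open>\<alpha> m\<close>, gives a three-term recurrence starting from \<open>s 0\<close> and
  \<open>s 1\<close>.\<close>

lemma LEC_span_first_two:
  assumes L: "LEC N \<alpha> s" and nz: "\<And>\<mu>. 0 < \<mu> \<Longrightarrow> \<mu> < N \<Longrightarrow> \<alpha> \<mu> \<noteq> 0" and "\<mu> < N"
  shows "s \<mu> \<in> span {s 0, s 1}"
  using \<open>\<mu> < N\<close>
proof (induction \<mu> rule: less_induct)
  case (less n)
  consider "n = 0" | "n = 1" | m where "n = Suc m" "0 < m"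
    by (metis One_nat_def not0_implies_Suc not_gr_zero)
  then show ?case
  proof cases
    case 3
    define h where "h = \<alpha> (m - 1) *\<^sub>R s (m - 1) + \<alpha> m *\<^sub>R s (Suc m)"
    have "h \<bullet> s m \<le> h \<bullet> x" if "norm x = 1" for x
    proof -
      have "spin_config N (s(m := x))"
        using L that by (simp add: LEC_def spin_config_def)
      then have "0 \<le> energy N \<alpha> (s(m := x)) - energy N \<alpha> s"
        using L by (simp add: LEC_def)
      then show ?thesis
        using 3 less.prems by (simp add: energy_fun_upd h_def inner_diff_right)
    qed
    moreover have "norm (s m) = 1"
      using L 3 less.prems by (simp add: LEC_def spin_config_def)
    ultimately have h: "h = - norm h *\<^sub>R s m"
      by (intro inner_unit_minimizer)
    have "\<alpha> m *\<^sub>R s n = - norm h *\<^sub>R s m - \<alpha> (m - 1) *\<^sub>R s (m - 1)"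
      using h 3 by (simp add: h_def algebra_simps)
    moreover have "s m \<in> span {s 0, s 1}" "s (m - 1) \<in> span {s 0, s 1}"
      using less.IH[of m] less.IH[of "m - 1"] 3 less.prems by auto
    ultimately have "\<alpha> m *\<^sub>R s n \<in> span {s 0, s 1}"
      by (metis span_diff span_scale)
    then have "inverse (\<alpha> m) *\<^sub>R \<alpha> m *\<^sub>R s n \<in> span {s 0, s 1}"
      by (rule span_scale)
    then show ?thesis
      using nz[of m] 3 less.prems by simp
  qed (auto intro: span_base)
qed

lemma LEC_collinear_or_coplanar:
  assumes L: "LEC N \<alpha> s" and nz: "\<And>\<mu>. 0 < \<mu> \<Longrightarrow> \<mu> < N \<Longrightarrow> \<alpha> \<mu> \<noteq> 0" and "0 < N"
  shows "coplanar_config N s \<longleftrightarrow> \<not> collinear_config N s"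
proof -
  have "s ` {..<N} \<subseteq> span {s 0, s 1}"
    using LEC_span_first_two[OF L nz] by auto
  then have "dim (s ` {..<N}) \<le> card {s 0, s 1}"
    by (intro dim_le_card) auto
  then have "dim (s ` {..<N}) \<le> 2"
    using card_insert_le_m1[of 2 "{s 1}" "s 0"] by simp
  moreover have "norm (s 0) = 1"
    using L \<open>0 < N\<close> by (simp add: LEC_def spin_config_def)
  then have "s 0 \<noteq> 0"
    by auto
  then have "dim (s ` {..<N}) \<noteq> 0"
    using \<open>0 < N\<close> by (auto simp: dim_eq_0 subset_iff)
  ultimately show ?thesis
    unfolding coplanar_config_def collinear_config_def dim_span by linarith
qed

lemma collinear_config_iff:
  assumes "spin_config N s" "0 < N"
  shows "collinear_config N s \<longleftrightarrow> (\<forall>\<mu><N. s \<mu> = s 0 \<or> s \<mu> = - s 0)"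
proof -
  have n0: "norm (s 0) = 1"
    using assms by (simp add: spin_config_def)
  then have nz: "s 0 \<noteq> 0"
    by auto
  have sub: "span {s 0} \<subseteq> span (s ` {..<N})"
    using assms by (intro span_mono) auto
  have d1: "dim (span {s 0}) = 1"
    using nz by (simp add: dim_span)
  show ?thesis
  proof
    assume "collinear_config N s"
    then have "span {s 0} = span (s ` {..<N})"
      using sub d1 by (intro subspace_dim_equal) (auto simp: collinear_config_def)
    then have "s \<mu> \<in> span {s 0}" if "\<mu> < N" for \<mu>
      using that by (auto intro: span_base)
    then have *: "\<exists>c. s \<mu> = c *\<^sub>R s 0" if "\<mu> < N" for \<mu>
      using that by (auto simp: span_singleton)
    show "\<forall>\<mu><N. s \<mu> = s 0 \<or> s \<mu> = - s 0"
    proof (intro allI impI)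
      fix \<mu> assume "\<mu> < N"
      then obtain c where c: "s \<mu> = c *\<^sub>R s 0"
        using * by blast
      moreover have "norm (s \<mu>) = 1"
        using assms \<open>\<mu> < N\<close> by (simp add: spin_config_def)
      ultimately have "\<bar>c\<bar> = 1"
        using n0 by simp
      then show "s \<mu> = s 0 \<or> s \<mu> = - s 0"
        using c by (auto simp: abs_if split: if_splits)
    qed
  next
    assume *: "\<forall>\<mu><N. s \<mu> = s 0 \<or> s \<mu> = - s 0"
    have "s \<mu> \<in> span {s 0}" if "\<mu> < N" for \<mu>
      using * that by (metis span_base span_neg singletonI)
    then have "span (s ` {..<N}) \<subseteq> span {s 0}"
      by (intro span_minimal) auto
    then show "collinear_config N s"
      using sub d1 by (auto simp: collinear_config_def)
  qed
qed

section \<open>Flipped spins and their bond differences\<close>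

text \<open>Reversing the spins outside the block \<open>1, \<dots>, \<tau>\<close> turns \<open>\<Psi>\<close> into the constant
  configuration and makes \<open>\<tau>\<close> the only antiferromagnetic bond.\<close>

definition flip_block :: "nat \<Rightarrow> (nat \<Rightarrow> real ^ 3) \<Rightarrow> nat \<Rightarrow> real ^ 3" where
  "flip_block \<tau> s \<mu> = (if 1 \<le> \<mu> \<and> \<mu> \<le> \<tau> then s \<mu> else - s \<mu>)"

lemma flip_block_flip_block [simp]: "flip_block \<tau> (flip_block \<tau> s) = s"
  by (auto simp: flip_block_def)

lemma norm_flip_block [simp]: "norm (flip_block \<tau> s \<mu>) = norm (s \<mu>)"
  by (simp add: flip_block_def)

lemma spin_config_flip_block [simp]: "spin_config N (flip_block \<tau> s) \<longleftrightarrow> spin_config N s"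
  by (simp add: spin_config_def)

text \<open>The differences are taken after the flip, so that they measure the deviation from
  \<open>\<Psi>\<close>, for which all of them vanish.\<close>

definition bond :: "nat \<Rightarrow> nat \<Rightarrow> (nat \<Rightarrow> real ^ 3) \<Rightarrow> nat \<Rightarrow> real ^ 3" where
  "bond N \<tau> s \<mu> = flip_block \<tau> s (Suc \<mu> mod N) - flip_block \<tau> s \<mu>"

text \<open>The assumption \<open>weakest\<close> also covers the index 0, so it contains
  \<open>\<bar>\<alpha> \<tau>\<bar> \<le> \<alpha> 0\<close>.\<close>

locale frustrated_ring =
  fixes N \<tau> :: nat and \<alpha> :: "nat \<Rightarrow> real"
  assumes N: "N > 2"
    and tau: "0 < \<tau>" "\<tau> < N"
    and pos0: "0 < \<alpha> 0"
    and neg: "\<And>\<mu>. 0 < \<mu> \<Longrightarrow> \<mu> < N \<Longrightarrow> \<alpha> \<mu> < 0"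
    and weakest: "\<And>\<mu>. \<mu> < N \<Longrightarrow> \<bar>\<alpha> \<tau>\<bar> \<le> \<bar>\<alpha> \<mu>\<bar>"
begin

abbreviation "B \<equiv> {..<N} - {\<tau>}"

text \<open>The energy of \<open>\<Psi>\<close>: every bond except \<open>\<tau>\<close> attains its
  own minimum.\<close>

definition "E\<^sub>\<Psi> = \<bar>\<alpha> \<tau>\<bar> - (\<Sum>\<mu>\<in>B. \<bar>\<alpha> \<mu>\<bar>)"

text \<open>As \<open>B\<close> contains 0, this is 1/alpha_0 + 1/alpha_(d). The phase boundary is
  \<open>\<bar>\<alpha> \<tau>\<bar> * S = 1\<close>.\<close>

definition "S = (\<Sum>\<mu>\<in>B. inverse \<bar>\<alpha> \<mu>\<bar>)"

lemma abs_pos: "\<mu> < N \<Longrightarrow> 0 < \<bar>\<alpha> \<mu>\<bar>"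
  using pos0 neg[of \<mu>] by (cases "\<mu> = 0") auto

lemma zero_in_B: "0 \<in> B"
  using tau N by simp

lemma S_pos: "S > 0"
  unfolding S_def using abs_pos zero_in_B by (intro sum_pos) auto

lemma sum_bond: "(\<Sum>\<mu>\<in>B. bond N \<tau> s \<mu>) = - bond N \<tau> s \<tau>"
proof -
  have "(\<Sum>\<mu><N. bond N \<tau> s \<mu>) = bond N \<tau> s \<tau> + (\<Sum>\<mu>\<in>B. bond N \<tau> s \<mu>)"
    using tau by (intro sum.remove) auto
  moreover have "(\<Sum>\<mu><N. bond N \<tau> s \<mu>) = 0"
    unfolding bond_def using N by (intro sum_cyclic_differences) simp
  ultimately show ?thesis
    by (metis add_eq_0_iff)
qed

text \<open>For unit vectors the inner product is 1 minus half the squared distance. The flip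
  reverses the sign of exactly the bonds 0 and \<open>\<tau>\<close>, so that only
  \<open>\<tau>\<close> enters with a negative weight.\<close>

lemma energy_eq:
  assumes s: "spin_config N s"
  shows "energy N \<alpha> s
    = E\<^sub>\<Psi> + ((\<Sum>\<mu>\<in>B. \<bar>\<alpha> \<mu>\<bar> * (norm (bond N \<tau> s \<mu>))\<^sup>2) - \<bar>\<alpha> \<tau>\<bar> * (norm (bond N \<tau> s \<tau>))\<^sup>2) / 2"
proof -
  have nb: "(norm (bond N \<tau> s \<mu>))\<^sup>2 = 2 - 2 * (flip_block \<tau> s \<mu> \<bullet> flip_block \<tau> s (Suc \<mu> mod N))" if "\<mu> < N" for \<mu>
  proof -
    have "norm (flip_block \<tau> s \<mu>) = 1" "norm (flip_block \<tau> s (Suc \<mu> mod N)) = 1"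
      using s that by (auto simp: spin_config_def)
    then show ?thesis
      unfolding bond_def power2_norm_eq_inner
      by (simp add: inner_diff_left inner_diff_right inner_commute norm_eq_1 del: norm_flip_block)
  qed
  have "\<alpha> \<mu> * (s \<mu> \<bullet> s (Suc \<mu> mod N)) = \<bar>\<alpha> \<mu>\<bar> * (norm (bond N \<tau> s \<mu>))\<^sup>2 / 2 - \<bar>\<alpha> \<mu>\<bar>"
    if "\<mu> \<in> B" for \<mu>
  proof (cases "\<mu> = 0")
    case True
    then show ?thesis
      using nb[of 0] N tau pos0 by (simp add: flip_block_def algebra_simps)
  next
    case False
    \<comment> \<open>The remaining bonds of \<open>B\<close> join sites on the same side of the
      block; the case \<open>Suc \<mu> = N\<close> wraps to site 0, which is outside.\<close>
    then have "flip_block \<tau> s \<mu> \<bullet> flip_block \<tau> s (Suc \<mu> mod N) = s \<mu> \<bullet> s (Suc \<mu> mod N)"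
      using that tau by (cases "Suc \<mu> = N") (auto simp: flip_block_def)
    then have inner: "s \<mu> \<bullet> s (Suc \<mu> mod N) = 1 - (norm (bond N \<tau> s \<mu>))\<^sup>2 / 2"
      using nb[of \<mu>] that by (simp add: field_simps)
    show ?thesis
      unfolding inner using neg[of \<mu>] that False by (simp add: algebra_simps)
  qed
  then have 1: "(\<Sum>\<mu>\<in>B. \<alpha> \<mu> * (s \<mu> \<bullet> s (Suc \<mu> mod N)))
      = (\<Sum>\<mu>\<in>B. \<bar>\<alpha> \<mu>\<bar> * (norm (bond N \<tau> s \<mu>))\<^sup>2) / 2 - (\<Sum>\<mu>\<in>B. \<bar>\<alpha> \<mu>\<bar>)"
    by (simp add: sum_subtractf sum_divide_distrib)
  \<comment> \<open>Site \<open>\<tau>\<close> is the last of the block and its successor is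
    outside, also when that successor is site 0.\<close>
  have "flip_block \<tau> s \<tau> \<bullet> flip_block \<tau> s (Suc \<tau> mod N) = - (s \<tau> \<bullet> s (Suc \<tau> mod N))"
    using tau by (cases "Suc \<tau> = N") (auto simp: flip_block_def)
  then have inner: "s \<tau> \<bullet> s (Suc \<tau> mod N) = (norm (bond N \<tau> s \<tau>))\<^sup>2 / 2 - 1"
    using nb[of \<tau>] tau by (simp add: field_simps)
  have 2: "\<alpha> \<tau> * (s \<tau> \<bullet> s (Suc \<tau> mod N)) = \<bar>\<alpha> \<tau>\<bar> - \<bar>\<alpha> \<tau>\<bar> * (norm (bond N \<tau> s \<tau>))\<^sup>2 / 2"
    unfolding inner using neg[of \<tau>] tau by (simp add: algebra_simps)
  have "energy N \<alpha> s = \<alpha> \<tau> * (s \<tau> \<bullet> s (Suc \<tau> mod N)) + (\<Sum>\<mu>\<in>B. \<alpha> \<mu> * (s \<mu> \<bullet> s (Suc \<mu> mod N)))"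
    unfolding energy_def using tau by (intro sum.remove) auto
  then show ?thesis
    unfolding 1 2 E\<^sub>\<Psi>_def by (simp add: field_simps)
qed

section \<open>The state Psi as the best collinear configuration\<close>

lemma Psi_state_iff: "Psi_state N \<tau> s \<longleftrightarrow> spin_config N s \<and> (\<forall>\<mu>\<in>B. bond N \<tau> s \<mu> = 0)"
proof -
  have b0: "bond N \<tau> s 0 = 0 \<longleftrightarrow> s 1 = - s 0"
    using N tau by (auto simp: bond_def flip_block_def eq_neg_iff_add_eq_0)
  have b: "bond N \<tau> s \<mu> = 0 \<longleftrightarrow> s (Suc \<mu> mod N) = s \<mu>" if "0 < \<mu>" "\<mu> < N" "\<mu> \<noteq> \<tau>" for \<mu>
    using that tau by (cases "Suc \<mu> = N") (auto simp: bond_def flip_block_def)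
  have bt: "bond N \<tau> s \<tau> = 0 \<longleftrightarrow> s (Suc \<tau> mod N) = - s \<tau>"
    using tau by (cases "Suc \<tau> = N") (auto simp: bond_def flip_block_def neg_eq_iff_add_eq_0 eq_neg_iff_add_eq_0)
  have B: "B = insert 0 {\<mu>. 0 < \<mu> \<and> \<mu> < N \<and> \<mu> \<noteq> \<tau>}"
    using N tau by auto
  \<comment> \<open>The bonds sum to zero around the ring, which yields the reversed bond at
    \<open>\<tau>\<close> from the others.\<close>
  have "bond N \<tau> s \<tau> = 0" if "\<forall>\<mu>\<in>B. bond N \<tau> s \<mu> = 0"
    using sum_bond[of s] that by simp
  then show ?thesis
    unfolding Psi_state_def B using b0 b bt by (simp add: ball_conj_distrib) blast
qed

lemma Psi_state_exists: "\<exists>s. Psi_state N \<tau> s"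
proof
  show "Psi_state N \<tau> (flip_block \<tau> (\<lambda>_. axis 1 1))"
    by (simp add: Psi_state_iff bond_def spin_config_def)
qed

lemma energy_Psi_state: "Psi_state N \<tau> s \<Longrightarrow> energy N \<alpha> s = E\<^sub>\<Psi>"
  using sum_bond[of s] by (simp add: Psi_state_iff energy_eq)

lemma collinear_Psi_state:
  assumes "Psi_state N \<tau> s"
  shows "collinear_config N s"
proof -
  have c: "spin_config N s" and b: "\<And>\<mu>. \<mu> \<in> B \<Longrightarrow> bond N \<tau> s \<mu> = 0"
    using assms by (auto simp: Psi_state_iff)
  have "bond N \<tau> s \<tau> = 0"
    using sum_bond[of s] b by simp
  then have b': "bond N \<tau> s \<mu> = 0" if "\<mu> < N" for \<mu>
    using that b by (cases "\<mu> = \<tau>") auto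
  have "flip_block \<tau> s \<mu> = flip_block \<tau> s 0" if "\<mu> < N" for \<mu>
    using that
  proof (induction \<mu>)
    case (Suc \<mu>)
    then show ?case
      using b'[of \<mu>] by (simp add: bond_def)
  qed simp
  then have "\<forall>\<mu><N. s \<mu> = s 0 \<or> s \<mu> = - s 0"
    by (auto simp: flip_block_def split: if_splits) (metis minus_minus)+
  then show ?thesis
    using c N by (simp add: collinear_config_iff)
qed

text \<open>On a line every squared bond is 0 or 4. If bond \<open>\<tau>\<close> is nonzero,
  another one must be too because they sum to zero, and by \<open>weakest\<close> it costs at least
  what \<open>\<tau>\<close> gains.\<close>

lemma collinear_energy_ge:
  assumes c: "spin_config N s" and "collinear_config N s"
  shows "E\<^sub>\<Psi> \<le> energy N \<alpha> s"
proof -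
  have s0: "s \<mu> = s 0 \<or> s \<mu> = - s 0" if "\<mu> < N" for \<mu>
    using assms N that by (simp add: collinear_config_iff)
  have n0: "norm (s 0) = 1"
    using c N by (simp add: spin_config_def)
  have g: "flip_block \<tau> s \<mu> = s 0 \<or> flip_block \<tau> s \<mu> = - s 0" if "\<mu> < N" for \<mu>
    using s0[OF that] by (auto simp: flip_block_def)
  have d: "bond N \<tau> s \<mu> = 0 \<or> (norm (bond N \<tau> s \<mu>))\<^sup>2 = 4" if "\<mu> < N" for \<mu>
  proof -
    have "norm (s 0 + s 0) = 2"
      using n0 norm_scaleR[of 2 "s 0"] by (simp only: scaleR_2)
    moreover have "norm (- s 0 - s 0) = norm (s 0 + s 0)"
      using norm_minus_cancel[of "s 0 + s 0"] by simp
    moreover have "Suc \<mu> mod N < N"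
      using N by simp
    ultimately show ?thesis
      using g[OF that] g[of "Suc \<mu> mod N"] by (auto simp: bond_def)
  qed
  have "\<bar>\<alpha> \<tau>\<bar> * (norm (bond N \<tau> s \<tau>))\<^sup>2 \<le> (\<Sum>\<mu>\<in>B. \<bar>\<alpha> \<mu>\<bar> * (norm (bond N \<tau> s \<mu>))\<^sup>2)"
  proof (cases "bond N \<tau> s \<tau> = 0")
    case True
    then show ?thesis
      by (simp add: sum_nonneg)
  next
    case False
    then obtain \<mu> where \<mu>: "\<mu> \<in> B" "bond N \<tau> s \<mu> \<noteq> 0"
      using sum_bond[of s] by (metis neg_equal_0_iff_equal sum.neutral)
    have "\<bar>\<alpha> \<tau>\<bar> * (norm (bond N \<tau> s \<tau>))\<^sup>2 \<le> \<bar>\<alpha> \<mu>\<bar> * (norm (bond N \<tau> s \<mu>))\<^sup>2"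
      using d[of \<mu>] d[of \<tau>] \<mu> False tau weakest[of \<mu>] by simp
    also have "\<dots> \<le> (\<Sum>\<mu>\<in>B. \<bar>\<alpha> \<mu>\<bar> * (norm (bond N \<tau> s \<mu>))\<^sup>2)"
      using \<mu> by (intro member_le_sum) auto
    finally show ?thesis .
  qed
  then show ?thesis
    using energy_eq[OF c] by simp
qed

section \<open>The collinear phase\<close>

text \<open>The weighted identity is applied to the bonds in \<open>B\<close>, whose sum is
  \<open>- bond N \<tau> s \<tau>\<close>; hence the plus sign inside the squares.\<close>

lemma energy_eq_squares:
  assumes "spin_config N s"
  shows "energy N \<alpha> s = E\<^sub>\<Psi> + ((inverse S - \<bar>\<alpha> \<tau>\<bar>) * (norm (bond N \<tau> s \<tau>))\<^sup>2
    + (\<Sum>\<mu>\<in>B. \<bar>\<alpha> \<mu>\<bar> * (norm (bond N \<tau> s \<mu> + (inverse \<bar>\<alpha> \<mu>\<bar> / S) *\<^sub>R bond N \<tau> s \<tau>))\<^sup>2)) / 2"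
proof -
  have "(\<Sum>\<mu>\<in>B. \<bar>\<alpha> \<mu>\<bar> * (norm (bond N \<tau> s \<mu>))\<^sup>2) = (norm (bond N \<tau> s \<tau>))\<^sup>2 / S
    + (\<Sum>\<mu>\<in>B. \<bar>\<alpha> \<mu>\<bar> * (norm (bond N \<tau> s \<mu> + (inverse \<bar>\<alpha> \<mu>\<bar> / S) *\<^sub>R bond N \<tau> s \<tau>))\<^sup>2)"
    using weighted_sum_norm_power2[of B "\<lambda>\<mu>. \<bar>\<alpha> \<mu>\<bar>" "bond N \<tau> s"] zero_in_B abs_pos
    unfolding sum_bond S_def[symmetric] by auto
  then show ?thesis
    using energy_eq[OF assms] by (simp add: field_simps)
qed

lemma supercritical:
  assumes crit: "\<bar>\<alpha> \<tau>\<bar> * S \<le> 1" and c: "spin_config N s"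
  shows energy_ge: "E\<^sub>\<Psi> \<le> energy N \<alpha> s"
    and energy_le_imp_Psi_state: "energy N \<alpha> s \<le> E\<^sub>\<Psi> \<Longrightarrow> Psi_state N \<tau> s"
proof -
  let ?v = "bond N \<tau> s \<tau>"
  let ?r = "\<lambda>\<mu>. bond N \<tau> s \<mu> + (inverse \<bar>\<alpha> \<mu>\<bar> / S) *\<^sub>R ?v"
  have 1: "0 \<le> (inverse S - \<bar>\<alpha> \<tau>\<bar>) * (norm ?v)\<^sup>2"
    using crit S_pos by (intro mult_nonneg_nonneg) (simp_all add: field_simps)
  have 2: "0 \<le> (\<Sum>\<mu>\<in>B. \<bar>\<alpha> \<mu>\<bar> * (norm (?r \<mu>))\<^sup>2)"
    by (simp add: sum_nonneg)
  show "E\<^sub>\<Psi> \<le> energy N \<alpha> s"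
    using 1 2 energy_eq_squares[OF c] by simp
  assume "energy N \<alpha> s \<le> E\<^sub>\<Psi>"
  \<comment> \<open>Only the remainder is used here: at the critical point the coefficient of
    \<open>(norm ?v)\<^sup>2\<close> is zero and gives no information on \<open>?v\<close>.\<close>
  then have "(\<Sum>\<mu>\<in>B. \<bar>\<alpha> \<mu>\<bar> * (norm (?r \<mu>))\<^sup>2) = 0"
    using 1 2 energy_eq_squares[OF c] by simp
  then have "\<bar>\<alpha> \<mu>\<bar> * (norm (?r \<mu>))\<^sup>2 = 0" if "\<mu> \<in> B" for \<mu>
    using that by (subst (asm) sum_nonneg_eq_0_iff) auto
  then have "?r \<mu> = 0" if "\<mu> \<in> B" for \<mu>
    using that abs_pos[of \<mu>] by auto
  then have r: "bond N \<tau> s \<mu> = (inverse \<bar>\<alpha> \<mu>\<bar> / S) *\<^sub>R (- ?v)" if "\<mu> \<in> B" for \<mu>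
    using that by (simp only: scaleR_minus_right eq_neg_iff_add_eq_0)
  \<comment> \<open>Starting just after \<open>\<tau>\<close>, \<open>N > 2\<close> provides two
    successive bonds in \<open>B\<close>. Both are positive multiples of \<open>- ?v\<close>, so
    they join three successive flipped spins along one line.\<close>
  define \<mu> where "\<mu> = Suc \<tau> mod N"
  have \<mu>: "\<mu> \<in> B" "Suc \<mu> mod N \<in> B"
    using N tau by (cases "Suc \<tau> = N"; cases "Suc (Suc \<tau>) = N"; simp add: \<mu>_def)+
  let ?a = "\<lambda>\<mu>. inverse \<bar>\<alpha> \<mu>\<bar> / S" and ?u = "flip_block \<tau> s"
  have n: "norm (?u k) = 1" if "k < N" for k
    using c that by (simp add: spin_config_def)
  have step: "?u (Suc k mod N) = ?u k + ?a k *\<^sub>R (- ?v)" if "k \<in> B" for k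
  proof -
    have "?u (Suc k mod N) = ?u k + bond N \<tau> s k"
      by (simp add: bond_def)
    then show ?thesis
      by (simp only: r[OF that])
  qed
  have step2: "?u (Suc (Suc \<mu> mod N) mod N) = ?u \<mu> + (?a \<mu> + ?a (Suc \<mu> mod N)) *\<^sub>R (- ?v)"
    unfolding step[OF \<mu>(2)] step[OF \<mu>(1)] by (simp only: scaleR_add_left add.assoc)
  \<comment> \<open>Otherwise three points of the unit sphere would lie on a line.\<close>
  have "- ?v = 0"
  proof (rule norm_add_scaleR_unit_unique)
    show "norm (?u \<mu>) = 1"
      using n \<mu> by blast
    show "norm (?u \<mu> + ?a \<mu> *\<^sub>R (- ?v)) = 1"
      unfolding step[OF \<mu>(1), symmetric] using N by (intro n) simp
    show "norm (?u \<mu> + (?a \<mu> + ?a (Suc \<mu> mod N)) *\<^sub>R (- ?v)) = 1"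
      unfolding step2[symmetric] using N by (intro n) simp
    show "0 < ?a \<mu>" "0 < ?a (Suc \<mu> mod N)"
      using abs_pos S_pos \<mu> by (auto intro!: divide_pos_pos)
  qed
  then show "Psi_state N \<tau> s"
    using c r by (simp add: Psi_state_iff)
qed

lemma LEC_iff_Psi_state:
  assumes "\<bar>\<alpha> \<tau>\<bar> * S \<le> 1"
  shows "LEC N \<alpha> s \<longleftrightarrow> Psi_state N \<tau> s"
proof
  assume L: "LEC N \<alpha> s"
  obtain t where t: "Psi_state N \<tau> t"
    using Psi_state_exists by blast
  then have "energy N \<alpha> s \<le> E\<^sub>\<Psi>"
    using L energy_Psi_state by (metis LEC_def Psi_state_def)
  then show "Psi_state N \<tau> s"
    using energy_le_imp_Psi_state[OF assms] L by (simp add: LEC_def)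
next
  assume "Psi_state N \<tau> s"
  then show "LEC N \<alpha> s"
    using energy_ge[OF assms] energy_Psi_state by (simp add: LEC_def Psi_state_def)
qed

section \<open>The coplanar phase\<close>

text \<open>Heights whose increments are the equality case of the weighted Cauchy--Schwarz inequality.\<close>

definition height :: "nat \<Rightarrow> real" where
  "height \<mu> = (if \<mu> \<le> \<tau> then \<Sum>k<\<mu>. inverse \<bar>\<alpha> k\<bar> else - (\<Sum>k\<in>{\<mu>..<N}. inverse \<bar>\<alpha> k\<bar>))"

text \<open>The two branches of \<open>height\<close> sum from site 0 in opposite directions and
  meet only at bond \<open>\<tau>\<close>. The wrap from \<open>N - 1\<close> to 0 fits because both
  empty sums are 0.\<close>

lemma height_step:
  assumes "\<mu> \<in> B"
  shows "height (Suc \<mu> mod N) - height \<mu> = inverse \<bar>\<alpha> \<mu>\<bar>"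
proof (cases "\<mu> < \<tau>")
  case True
  then show ?thesis
    using tau by (simp add: height_def)
next
  case False
  then have "(\<Sum>k\<in>{\<mu>..<N}. inverse \<bar>\<alpha> k\<bar>) = inverse \<bar>\<alpha> \<mu>\<bar> + (\<Sum>k\<in>{Suc \<mu>..<N}. inverse \<bar>\<alpha> k\<bar>)"
    using assms by (intro sum.atLeast_Suc_lessThan) auto
  then show ?thesis
    using False assms by (cases "Suc \<mu> = N") (auto simp: height_def)
qed

lemma height_step_tau: "height (Suc \<tau> mod N) - height \<tau> = - S"
proof -
  have "(\<Sum>\<mu>\<in>B. height (Suc \<mu> mod N) - height \<mu>) = S"
    unfolding S_def by (intro sum.cong refl height_step)
  then show ?thesis
    using sum_cyclic_differences[of N height] N tau
      sum.remove[of "{..<N}" \<tau> "\<lambda>\<mu>. height (Suc \<mu> mod N) - height \<mu>"] by simp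
qed

text \<open>For small angles the energy exceeds \<open>E\<^sub>\<Psi>\<close> by about
  \<open>\<epsilon>\<^sup>2 * S / 2 * (1 - \<bar>\<alpha> \<tau>\<bar> * S)\<close>, which is
  negative.\<close>

lemma subcritical:
  assumes crit: "1 < \<bar>\<alpha> \<tau>\<bar> * S"
  shows "\<exists>s. spin_config N s \<and> energy N \<alpha> s < E\<^sub>\<Psi>"
proof -
  \<comment> \<open>Planar rotation by the angles \<open>\<epsilon> * height \<mu>\<close>; the
    value \<open>\<epsilon> = 0\<close> corresponds to \<open>\<Psi>\<close>.\<close>
  define u :: "real \<Rightarrow> nat \<Rightarrow> real^3" where
    "u \<epsilon> \<mu> = cos (\<epsilon> * height \<mu>) *\<^sub>R axis 1 1 + sin (\<epsilon> * height \<mu>) *\<^sub>R axis 2 1" for \<epsilon> \<mu>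
  have inner_u: "u \<epsilon> \<mu> \<bullet> u \<epsilon> \<nu> = cos (\<epsilon> * (height \<nu> - height \<mu>))" for \<epsilon> \<mu> \<nu>
    by (simp add: u_def inner_add_left inner_add_right inner_axis_axis cos_diff right_diff_distrib)
  have c: "spin_config N (flip_block \<tau> (u \<epsilon>))" for \<epsilon>
    by (simp add: spin_config_def norm_eq_1 inner_u)
  have nb: "(norm (bond N \<tau> (flip_block \<tau> (u \<epsilon>)) \<mu>))\<^sup>2
      = 2 * (1 - cos (\<epsilon> * (height (Suc \<mu> mod N) - height \<mu>)))" for \<epsilon> \<mu>
    unfolding bond_def power2_norm_eq_inner flip_block_flip_block inner_diff_left inner_diff_right inner_u
    by (simp add: cos_diff right_diff_distrib)
  have E: "energy N \<alpha> (flip_block \<tau> (u \<epsilon>)) \<le> E\<^sub>\<Psi> + \<epsilon>\<^sup>2 * S / 2 - \<bar>\<alpha> \<tau>\<bar> * (1 - cos (\<epsilon> * S))" for \<epsilon>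
  proof -
    have "\<bar>\<alpha> \<mu>\<bar> * (norm (bond N \<tau> (flip_block \<tau> (u \<epsilon>)) \<mu>))\<^sup>2 \<le> \<epsilon>\<^sup>2 * inverse \<bar>\<alpha> \<mu>\<bar>" if "\<mu> \<in> B" for \<mu>
    proof -
      \<comment> \<open>A chord is at most its arc. This bounds the cost of the bonds in
        \<open>B\<close> for every \<open>\<epsilon>\<close>, while the gain at
        \<open>\<tau>\<close> is kept exact.\<close>
      have "2 * (1 - cos x) \<le> x\<^sup>2" for x :: real
      proof -
        have "1 - cos x = 2 * (sin (x / 2))\<^sup>2"
          using cos_double_sin[of "x / 2"] by simp
        moreover have "(sin (x / 2))\<^sup>2 \<le> (x / 2)\<^sup>2"
          using abs_sin_x_le_abs_x[of "x / 2"] by (simp only: abs_le_square_iff)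
        ultimately show ?thesis
          by (simp add: power2_eq_square)
      qed
      then have "(norm (bond N \<tau> (flip_block \<tau> (u \<epsilon>)) \<mu>))\<^sup>2 \<le> (\<epsilon> * inverse \<bar>\<alpha> \<mu>\<bar>)\<^sup>2"
        unfolding nb height_step[OF that] .
      then have "\<bar>\<alpha> \<mu>\<bar> * (norm (bond N \<tau> (flip_block \<tau> (u \<epsilon>)) \<mu>))\<^sup>2 \<le> \<bar>\<alpha> \<mu>\<bar> * (\<epsilon> * inverse \<bar>\<alpha> \<mu>\<bar>)\<^sup>2"
        by (intro mult_left_mono) auto
      also have "\<dots> = \<epsilon>\<^sup>2 * inverse \<bar>\<alpha> \<mu>\<bar>"
        using abs_pos[of \<mu>] that by (simp add: field_simps power2_eq_square)
      finally show ?thesis .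
    qed
    then have "(\<Sum>\<mu>\<in>B. \<bar>\<alpha> \<mu>\<bar> * (norm (bond N \<tau> (flip_block \<tau> (u \<epsilon>)) \<mu>))\<^sup>2) \<le> \<epsilon>\<^sup>2 * S"
      unfolding S_def sum_distrib_left by (intro sum_mono)
    moreover have norm_tau: "(norm (bond N \<tau> (flip_block \<tau> (u \<epsilon>)) \<tau>))\<^sup>2 = 2 * (1 - cos (\<epsilon> * S))"
      unfolding nb height_step_tau by simp
    ultimately show ?thesis
      unfolding energy_eq[OF c] norm_tau by (simp add: field_simps)
  qed
  \<comment> \<open>The gain at \<open>\<tau>\<close> needs a bound from below, which the
    second-order limit supplies for small \<open>\<epsilon>\<close>.\<close>
  have "((\<lambda>\<epsilon>. (1 - cos (\<epsilon> * c)) / \<epsilon>\<^sup>2) \<longlongrightarrow> c\<^sup>2 / 2) (at_right 0)" if "0 < c" for c :: real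
    using that unfolding power2_eq_square by real_asymp
  from this[OF S_pos] have "((\<lambda>\<epsilon>. (1 - cos (\<epsilon> * S)) / \<epsilon>\<^sup>2) \<longlongrightarrow> S\<^sup>2 / 2) (at_right 0)" .
  \<comment> \<open>This is \<open>crit\<close> multiplied by the positive factor
    \<open>S / (2 * \<bar>\<alpha> \<tau>\<bar>)\<close>; the gap leaves room for the limit
    argument.\<close>
  moreover have "S / (2 * \<bar>\<alpha> \<tau>\<bar>) < S\<^sup>2 / 2"
    using crit S_pos abs_pos[of \<tau>] tau by (simp add: field_simps power2_eq_square)
  ultimately have "\<forall>\<^sub>F \<epsilon> in at_right 0. S / (2 * \<bar>\<alpha> \<tau>\<bar>) < (1 - cos (\<epsilon> * S)) / \<epsilon>\<^sup>2"
    by (rule order_tendstoD)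
  moreover have "\<forall>\<^sub>F \<epsilon> in at_right (0::real). 0 < \<epsilon>"
    by (simp add: eventually_at_right_less)
  ultimately have "\<forall>\<^sub>F \<epsilon> in at_right 0. 0 < \<epsilon> \<and> S / (2 * \<bar>\<alpha> \<tau>\<bar>) < (1 - cos (\<epsilon> * S)) / \<epsilon>\<^sup>2"
    by eventually_elim simp
  then obtain \<epsilon> where "\<epsilon> > 0" "S / (2 * \<bar>\<alpha> \<tau>\<bar>) < (1 - cos (\<epsilon> * S)) / \<epsilon>\<^sup>2"
    using eventually_happens'[OF trivial_limit_at_right_real] by blast
  then have "\<epsilon>\<^sup>2 * S / 2 < \<bar>\<alpha> \<tau>\<bar> * (1 - cos (\<epsilon> * S))"
    using abs_pos[of \<tau>] tau by (simp add: field_simps)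
  then have "energy N \<alpha> (flip_block \<tau> (u \<epsilon>)) < E\<^sub>\<Psi>"
    using E[of \<epsilon>] by simp
  then show ?thesis
    using c by blast
qed

text \<open>A collinear minimizer has energy at least \<open>E\<^sub>\<Psi>\<close>, which is
  impossible where \<open>subcritical\<close> goes below that value.\<close>

lemma LEC_collinear_iff:
  assumes "LEC N \<alpha> s"
  shows "collinear_config N s \<longleftrightarrow> \<bar>\<alpha> \<tau>\<bar> * S \<le> 1"
proof
  assume "collinear_config N s"
  then have "E\<^sub>\<Psi> \<le> energy N \<alpha> s"
    using assms collinear_energy_ge by (simp add: LEC_def)
  then have "\<not> (\<exists>t. spin_config N t \<and> energy N \<alpha> t < E\<^sub>\<Psi>)"
    using assms unfolding LEC_def by fastforce
  then show "\<bar>\<alpha> \<tau>\<bar> * S \<le> 1"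
    using subcritical not_le by blast
next
  assume "\<bar>\<alpha> \<tau>\<bar> * S \<le> 1"
  then show "collinear_config N s"
    using assms LEC_iff_Psi_state collinear_Psi_state by blast
qed

end

section \<open>Passage to the critical coupling\<close>

theorem mainTheorem11:
  fixes N \<tau> :: nat and \<alpha> :: "nat \<Rightarrow> real"
  assumes "N > 2"
    and "\<And>\<mu>. 0 < \<mu> \<Longrightarrow> \<mu> < N \<Longrightarrow> \<alpha> \<mu> < 0"
    and "\<tau> \<in> {1..<N}"
    and "\<bar>\<alpha> \<tau>\<bar> = Min ((\<lambda>\<mu>. \<bar>\<alpha> \<mu>\<bar>) ` {1..<N})"
    and "\<bar>\<alpha> \<tau>\<bar> < alpha_d N \<alpha> \<tau>"
  shows "0 < alpha_c' N \<alpha> \<tau> \<and> \<bar>\<alpha> \<tau>\<bar> < alpha_c' N \<alpha> \<tau> \<and>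
    (\<forall>\<alpha>\<^sub>0 > \<bar>\<alpha> \<tau>\<bar>.
       (\<exists>s. LEC N (\<alpha>(0 := \<alpha>\<^sub>0)) s) \<and>
       (\<forall>s. LEC N (\<alpha>(0 := \<alpha>\<^sub>0)) s \<longrightarrow>
          (collinear_config N s \<longleftrightarrow> alpha_c' N \<alpha> \<tau> \<le> \<alpha>\<^sub>0) \<and>
          (coplanar_config N s \<longleftrightarrow> \<alpha>\<^sub>0 < alpha_c' N \<alpha> \<tau>)) \<and>
       (alpha_c' N \<alpha> \<tau> \<le> \<alpha>\<^sub>0 \<longrightarrow>
          (\<forall>s. LEC N (\<alpha>(0 := \<alpha>\<^sub>0)) s \<longleftrightarrow> Psi_state N \<tau> s)))"
proof -
  let ?w = "\<bar>\<alpha> \<tau>\<bar>" and ?D = "alpha_d N \<alpha> \<tau>" and ?c = "alpha_c' N \<alpha> \<tau>"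
  have tau: "0 < \<tau>" "\<tau> < N"
    using assms(3) by auto
  have w: "0 < ?w"
    using assms(2)[OF tau] by simp
  have D: "0 < inverse ?D" "inverse ?D < inverse ?w"
    using assms(5) w by (auto intro: less_imp_inverse_less)
  \<comment> \<open>\<open>inverse\<close> is an involution even at 0, so this identity precedes the
    proof that \<open>?c\<close> is positive.\<close>
  have c: "inverse ?c = inverse ?w - inverse ?D"
    by (simp add: alpha_c'_def)
  then have c_pos: "0 < ?c"
    using D by (metis diff_gt_0_iff_gt inverse_positive_iff_positive)
  have "inverse ?c < inverse ?w"
    using c D by simp
  then have c_gt: "?w < ?c"
    using c_pos by (rule inverse_less_imp_less)
  have main: "(\<exists>s. LEC N (\<alpha>(0 := a)) s) \<and>
       (\<forall>s. LEC N (\<alpha>(0 := a)) s \<longrightarrow>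
          (collinear_config N s \<longleftrightarrow> ?c \<le> a) \<and> (coplanar_config N s \<longleftrightarrow> a < ?c)) \<and>
       (?c \<le> a \<longrightarrow> (\<forall>s. LEC N (\<alpha>(0 := a)) s \<longleftrightarrow> Psi_state N \<tau> s))" if a: "?w < a" for a
  proof -
    let ?\<alpha> = "\<alpha>(0 := a)"
    have a_pos: "0 < a"
      using a w by linarith
    have min: "?w \<le> \<bar>\<alpha> \<mu>\<bar>" if "0 < \<mu>" "\<mu> < N" for \<mu>
      unfolding assms(4) using that by (intro Min_le) auto
    \<comment> \<open>The restriction \<open>?w < a\<close> is what makes \<open>\<tau>\<close>
      weakest among all bonds, the one at 0 included.\<close>
    interpret frustrated_ring N \<tau> ?\<alpha>
    proof
      show "\<bar>?\<alpha> \<tau>\<bar> \<le> \<bar>?\<alpha> \<mu>\<bar>" if "\<mu> < N" for \<mu>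
        using min[of \<mu>] that tau a by auto
    qed (use assms tau a w in auto)
    have "B = insert 0 ({1..<N} - {\<tau>})"
      using tau by auto
    then have "S = inverse \<bar>a\<bar> + (\<Sum>\<mu>\<in>{1..<N} - {\<tau>}. inverse \<bar>?\<alpha> \<mu>\<bar>)"
      unfolding S_def using tau by simp
    also have "(\<Sum>\<mu>\<in>{1..<N} - {\<tau>}. inverse \<bar>?\<alpha> \<mu>\<bar>) = inverse ?D"
      unfolding alpha_d_def inverse_inverse_eq by (intro sum.cong) auto
    finally have S: "S = inverse a + inverse ?D"
      by (simp only: abs_of_pos[OF a_pos])
    \<comment> \<open>Subtracting 1/alpha_(d) turns the threshold on \<open>S\<close> into a
      comparison of reciprocals, which reverses for positive numbers.\<close>
    have "\<bar>?\<alpha> \<tau>\<bar> * S \<le> 1 \<longleftrightarrow> S \<le> inverse ?w"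
      using w tau by (simp add: field_simps)
    also have "\<dots> \<longleftrightarrow> inverse a \<le> inverse ?c"
      unfolding S c by auto
    also have "\<dots> \<longleftrightarrow> ?c \<le> a"
      using c_pos a w by (intro inverse_le_iff_le) auto
    finally have crit: "\<bar>?\<alpha> \<tau>\<bar> * S \<le> 1 \<longleftrightarrow> ?c \<le> a" .
    have nz: "?\<alpha> \<mu> \<noteq> 0" if "0 < \<mu>" "\<mu> < N" for \<mu>
      using assms(2)[OF that] that by simp
    have "collinear_config N s \<longleftrightarrow> ?c \<le> a" "coplanar_config N s \<longleftrightarrow> a < ?c" if "LEC N ?\<alpha> s" for s
      using LEC_collinear_iff[OF that] LEC_collinear_or_coplanar[OF that nz] crit \<open>N > 2\<close> by auto
    moreover have "LEC N ?\<alpha> s \<longleftrightarrow> Psi_state N \<tau> s" if "?c \<le> a" for s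
      using LEC_iff_Psi_state crit that by blast
    ultimately show ?thesis
      using LEC_exists by blast
  qed
  show ?thesis
    using c_pos c_gt main by blast
qed

end
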